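(* Let $A\in\mathbb{R}[\mathtt{x}]^{\alpha\times\alpha}$ be a linear pencil in the variables $\mathtt{x}=(\mathtt{x}_1,\dots,\mathtt{x}_n)$, with associated spectrahedron $S_A$ and associated quadratic module $M_A$. Then $$S_A=\emptyset\quad\Longleftrightarrow\quad -1\in M_A .$$
   Context: Let $\mathtt{x}=(\mathtt{x}_1,\dots,\mathtt{x}_n)$ be commuting variables and $\mathbb{R}[\mathtt{x}]$ the polynomial ring. A linear pencil of size $\alpha$ is a symmetric matrix $A\in\mathbb{R}[\mathtt{x}]^{\alpha\times\alpha}$ all of whose entries have degree at most $1$, i.e. $A=A_0+\mathtt{x}_1A_1+\dots+\mathtt{x}_nA_n$ with real symmetric $\alpha\times\alpha$ matrices $A_i$. Its spectrahedron is $S_A:=\{x\in\mathbb{R}^n\mid A(x)\succeq 0\}$, where $\succeq0$ means positive semidefinite. The quadratic module associated to $A$ is $$M_A:=\Big\{s+\sum_i v_i^*Av_i\ \Big|\ s\in\sum\mathbb{R}[\mathtt{x}]^2,\ v_i\in\mathbb{R}[\mathtt{x}]^\alpha\Big\}\subseteq\mathbb{R}[\mathtt{x}],$$ where $^*$ denotes transpose, the sums are finite, and $\sum\mathbb{R}[\mathtt{x}]^2$ is the set of finite sums of squares of polynomials. *)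

theory Defs
  imports "HOL-Library.Poly_Mapping" "Jordan_Normal_Form.Matrix"
begin

(* Monomials are exponent maps. Variables are indexed from 0, so x_1, ..., x_n have the
   indices 0, ..., n-1; the type has countably many variables, and polys n below is R[x_1,...,x_n]. *)
type_synonym real_poly = "(nat \<Rightarrow>\<^sub>0 nat) \<Rightarrow>\<^sub>0 real"

definition polys :: "nat \<Rightarrow> real_poly set" where
  "polys n = {p. \<forall>m \<in> Poly_Mapping.keys p. Poly_Mapping.keys m \<subseteq> {..<n}}"

definition monomial_degree :: "(nat \<Rightarrow>\<^sub>0 nat) \<Rightarrow> nat" where
  "monomial_degree m = (\<Sum>i \<in> Poly_Mapping.keys m. Poly_Mapping.lookup m i)"

(* The zero polynomial gets degree 0, which is harmless for the bound "degree at most 1". *)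
definition total_degree :: "real_poly \<Rightarrow> nat" where
  "total_degree p = Max (insert 0 (monomial_degree ` Poly_Mapping.keys p))"

definition eval_poly :: "real vec \<Rightarrow> real_poly \<Rightarrow> real" where
  "eval_poly x p = (\<Sum>m \<in> Poly_Mapping.keys p.
     Poly_Mapping.lookup p m * (\<Prod>i \<in> Poly_Mapping.keys m. (x $ i) ^ Poly_Mapping.lookup m i))"

definition linear_pencil :: "nat \<Rightarrow> nat \<Rightarrow> real_poly mat \<Rightarrow> bool" where
  "linear_pencil n \<alpha> A \<longleftrightarrow> A \<in> carrier_mat \<alpha> \<alpha> \<and> transpose_mat A = A \<and>
     (\<forall>i<\<alpha>. \<forall>j<\<alpha>. A $$ (i, j) \<in> polys n \<and> total_degree (A $$ (i, j)) \<le> 1)"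

definition pos_semidef :: "real mat \<Rightarrow> bool" where
  "pos_semidef B \<longleftrightarrow> square_mat B \<and> transpose_mat B = B \<and>
     (\<forall>v \<in> carrier_vec (dim_row B). 0 \<le> v \<bullet> (B *\<^sub>v v))"

definition spectrahedron :: "nat \<Rightarrow> real_poly mat \<Rightarrow> real vec set" where
  "spectrahedron n A = {x \<in> carrier_vec n. pos_semidef (map_mat (eval_poly x) A)}"

definition sums_of_squares :: "nat \<Rightarrow> real_poly set" where
  "sums_of_squares n = {(\<Sum>i<k. q i ^ 2) | k q. \<forall>i<(k::nat). q i \<in> polys n}"

definition poly_vecs :: "nat \<Rightarrow> nat \<Rightarrow> real_poly vec set" where
  "poly_vecs n \<alpha> = {v \<in> carrier_vec \<alpha>. \<forall>i<\<alpha>. v $ i \<in> polys n}"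

definition quadratic_module :: "nat \<Rightarrow> real_poly mat \<Rightarrow> real_poly set" where
  "quadratic_module n A =
     {s + (\<Sum>i<k. v i \<bullet> (A *\<^sub>v v i)) | s k v.
        s \<in> sums_of_squares n \<and> (\<forall>i<(k::nat). v i \<in> poly_vecs n (dim_row A))}"

end

theory Submission
  imports Defs "HOL-Analysis.Finite_Function_Topology"
begin

text \<open>
  Suppose \<open>-1 \<notin> M\<^sub>A\<close> and enlarge \<open>M\<^sub>A\<close> to a maximal proper quadratic module \<open>M\<close>. Then
  \<open>M \<union> -M\<close> is everything and \<open>I = M \<inter> -M\<close> is an ideal. The key algebraic step is that
  \<open>u\<^sup>TAu \<in> I\<close> forces \<open>w\<^sup>TAu \<in> I\<close> for all \<open>w\<close>; hence, modulo the vectors with \<open>u\<^sup>TAu \<in> I\<close>, the form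
  \<open>u\<^sup>TAu\<close> takes strictly positive values in the total order on polynomials defined by \<open>M\<close>. On the compact unit
  sphere such a strictly positive family of affine polynomials is separated from \<open>0\<close> by a linear
  functional that kills \<open>I\<close> and is positive at \<open>1\<close>. Normalized, this functional is the evaluation
  at a point of the spectrahedron.
\<close>

section \<open>Separation in totally preordered real vector spaces\<close>

text \<open>Only the compact part \<open>C\<close> of \<open>K\<close> with
  \<open>g x \<le> 0\<close> can fail. There \<open>f\<close> has a positive minimum and
  \<open>g\<close> a finite one, so a large multiple of \<open>f\<close> outweighs \<open>g\<close>;
  elsewhere any \<open>t \<ge> 0\<close> works.\<close>

lemma compact_penalty:
  fixes f g :: "'x::topological_space \<Rightarrow> real"
  assumes K: "compact K" and f: "continuous_on K f" and g: "continuous_on K g"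
    and nonneg: "\<And>x. x \<in> K \<Longrightarrow> 0 \<le> f x"
    and pos: "\<And>x. x \<in> K \<Longrightarrow> f x = 0 \<Longrightarrow> 0 < g x"
  shows "\<exists>t. \<forall>x\<in>K. 0 < t * f x + g x"
proof -
  define C where "C = K \<inter> g -` {..0}"
  have "closedin (top_of_set K) C"
    unfolding C_def by (rule continuous_closedin_preimage[OF g]) auto
  then have C: "compact C"
    using K closedin_compact by blast
  show ?thesis
  proof (cases "C = {}")
    case True
    then show ?thesis
      by (intro exI[of _ 0]) (auto simp: C_def)
  next
    case False
    have CK: "C \<subseteq> K" by (auto simp: C_def)
    obtain y where y: "y \<in> C" "\<And>x. x \<in> C \<Longrightarrow> f y \<le> f x"
      using continuous_attains_inf[OF C False continuous_on_subset[OF f CK]] by auto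
    have fy: "0 < f y"
      using y(1) nonneg[of y] pos[of y] by (force simp: C_def)
    obtain z where z: "z \<in> C" "\<And>x. x \<in> C \<Longrightarrow> g z \<le> g x"
      using continuous_attains_inf[OF C False continuous_on_subset[OF g CK]] by auto
    define t where "t = (1 - g z) / f y"
    have t: "0 \<le> t" using fy z(1) by (auto simp: t_def C_def)
    have "0 < t * f x + g x" if "x \<in> K" for x
    proof (cases "x \<in> C")
      case True
      have "1 - g z = t * f y" using fy by (simp add: t_def)
      also have "\<dots> \<le> t * f x" using y(2)[OF True] t by (rule mult_left_mono)
      finally show ?thesis using z(2)[OF True] by linarith
    next
      case False
      then have "0 < g x" using that by (auto simp: C_def)
      then show ?thesis using t nonneg[OF that] by (simp add: add_nonneg_pos)
    qed
    then show ?thesis by blast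
  qed
qed

section \<open>Total preorders on real vector spaces and archimedean classes\<close>

locale total_cone =
  fixes P :: "'a::real_vector set"
  assumes add: "v \<in> P \<Longrightarrow> w \<in> P \<Longrightarrow> v + w \<in> P"
    and scale: "0 \<le> r \<Longrightarrow> v \<in> P \<Longrightarrow> r *\<^sub>R v \<in> P"
    and total: "v \<in> P \<or> - v \<in> P"
begin

text \<open>With \<open>v \<le> w\<close> meaning \<open>w - v \<in> P\<close>, these are the
  elements equivalent to 0 in the total preorder. For a quadratic module this is its
  support.\<close>

definition neutral :: "'a set" where
  "neutral = {v. v \<in> P \<and> - v \<in> P}"

lemma zero [simp]: "0 \<in> P"
  using total[of 0] by simp

lemma subspace_neutral: "subspace neutral"
proof (rule subspaceI)
  fix r :: real and v assume v: "v \<in> neutral"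
  show "r *\<^sub>R v \<in> neutral"
    using v scale[of "\<bar>r\<bar>" v] scale[of "\<bar>r\<bar>" "- v"]
    by (cases "0 \<le> r") (auto simp: neutral_def)
next
  fix v w assume v: "v \<in> neutral" "w \<in> neutral"
  then have "- v + - w \<in> P" by (intro add) (auto simp: neutral_def)
  then show "v + w \<in> neutral" using v by (auto simp: neutral_def intro: add)
qed (simp add: neutral_def)

lemma neutral_if_sandwiched:
  assumes "h \<in> neutral" "r *\<^sub>R h - v \<in> P" "v \<in> P"
  shows "v \<in> neutral"
proof -
  have "- (r *\<^sub>R h) \<in> P"
    using subspace_scale[OF subspace_neutral assms(1), of r] by (simp add: neutral_def)
  then have "- (r *\<^sub>R h) + (r *\<^sub>R h - v) \<in> P" using assms(2) by (rule add)
  then show ?thesis using assms(3) by (simp add: neutral_def)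
qed

text \<open>By totality \<open>- h \<notin> P\<close> makes \<open>h\<close> strictly positive. If
  \<open>r\<close> were negative, rescaling \<open>r *\<^sub>R h\<close> would put
  \<open>- h\<close> into \<open>P\<close>.\<close>

lemma negative_multiple:
  assumes "- h \<notin> P" "r *\<^sub>R h \<in> P"
  shows "0 \<le> r"
proof (rule ccontr)
  assume "\<not> 0 \<le> r"
  then have "(1 / (- r)) *\<^sub>R (r *\<^sub>R h) = - h" "0 \<le> 1 / (- r)" by auto
  then show False using scale[OF _ assms(2)] assms(1) by metis
qed

text \<open>The standard part \<open>l\<close> of \<open>v\<close> relative to \<open>h\<close> is
  the supremum of all \<open>r\<close> with \<open>v - r *\<^sub>R h \<in> P\<close>. The bounds by
  \<open>C\<close> make it finite, and above it totality gives the reverse inequality.\<close>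

lemma standard_part_exists:
  assumes "- h \<notin> P" "C *\<^sub>R h - v \<in> P" "C *\<^sub>R h + v \<in> P"
  shows "\<exists>l. \<forall>e>0. (l + e) *\<^sub>R h - v \<in> P \<and> v - (l - e) *\<^sub>R h \<in> P"
proof -
  have h: "h \<in> P" using total[of h] assms(1) by simp
  define S where "S = {r. v - r *\<^sub>R h \<in> P}"
  have ne: "- C \<in> S" using assms(3) by (simp add: S_def add.commute)
  have "r \<le> C" if "r \<in> S" for r
  proof -
    have "(C *\<^sub>R h - v) + (v - r *\<^sub>R h) \<in> P"
      using that assms(2) by (intro add) (auto simp: S_def)
    then have "(C - r) *\<^sub>R h \<in> P" by (simp add: algebra_simps)
    then show ?thesis using negative_multiple[OF assms(1)] by force
  qed
  then have bdd: "bdd_above S" by (auto simp: bdd_above_def)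
  define l where "l = Sup S"
  have "(l + e) *\<^sub>R h - v \<in> P \<and> v - (l - e) *\<^sub>R h \<in> P" if "0 < e" for e
  proof
    have "l + e \<notin> S" using cSup_upper[OF _ bdd, of "l + e"] that by (auto simp: l_def)
    then show "(l + e) *\<^sub>R h - v \<in> P"
      using total[of "v - (l + e) *\<^sub>R h"] by (simp add: S_def)
    obtain r where r: "r \<in> S" "l - e < r"
      using less_cSup_iff[OF _ bdd, of "l - e"] ne \<open>0 < e\<close> by (fastforce simp: l_def)
    have "(v - r *\<^sub>R h) + (r - (l - e)) *\<^sub>R h \<in> P"
      using r h by (intro add scale) (auto simp: S_def)
    then show "v - (l - e) *\<^sub>R h \<in> P" by (simp add: algebra_simps)
  qed
  then show ?thesis by blast
qed

text \<open>Finds a member of largest archimedean class. If \<open>h\<close> dominates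
  \<open>D\<close> but not \<open>x\<close>, then by totality \<open>b x\<close> exceeds every
  multiple of \<open>b h\<close> and hence dominates everything.\<close>

lemma dominant_positive_element:
  assumes "finite D" "D \<noteq> {}" "\<And>k. k \<in> D \<Longrightarrow> b k \<in> P"
  shows "\<exists>h\<in>D. \<forall>k\<in>D. \<exists>C. C *\<^sub>R b h - b k \<in> P"
  using assms
proof (induction D rule: finite_ne_induct)
  case (singleton x)
  then show ?case by (auto intro: exI[of _ 1])
next
  case (insert x D)
  then obtain h where h: "h \<in> D" "\<And>k. k \<in> D \<Longrightarrow> \<exists>C. C *\<^sub>R b h - b k \<in> P" by auto
  show ?case
  proof (cases "\<exists>C. C *\<^sub>R b h - b x \<in> P")
    case True
    then show ?thesis using h by auto
  next
    case False
    have x: "b x - C *\<^sub>R b h \<in> P" for C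
      using False total[of "b x - C *\<^sub>R b h"] by auto
    have "1 *\<^sub>R b x - b k \<in> P" if k: "k \<in> D" for k
    proof -
      obtain C where "C *\<^sub>R b h - b k \<in> P" using h(2)[OF k] by blast
      from add[OF x[of C] this] show ?thesis by simp
    qed
    moreover have "1 *\<^sub>R b x - b x \<in> P" by simp
    ultimately show ?thesis by blast
  qed
qed

text \<open>Signs make all elements nonnegative before the largest class is chosen. Its
  representative is strictly positive: otherwise it would be neutral, and \<open>b k0\<close>, being
  dominated by it up to sign, would be neutral too.\<close>

lemma dominant_element:
  assumes "finite D" "k0 \<in> D" "b k0 \<notin> neutral"
  shows "\<exists>h\<in>D. \<exists>s\<in>{1, -1}. - (s *\<^sub>R b h) \<notin> P \<and>
    (\<forall>k\<in>D. \<exists>C. C *\<^sub>R (s *\<^sub>R b h) - b k \<in> P \<and> C *\<^sub>R (s *\<^sub>R b h) + b k \<in> P)"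
proof -
  define s where "s k = (if b k \<in> P then 1 else -1 :: real)" for k
  have sP: "s k *\<^sub>R b k \<in> P" for k using total[of "b k"] by (auto simp: s_def)
  obtain h where h: "h \<in> D" "\<And>k. k \<in> D \<Longrightarrow> \<exists>C. C *\<^sub>R (s h *\<^sub>R b h) - s k *\<^sub>R b k \<in> P"
    using dominant_positive_element[OF assms(1), of "\<lambda>k. s k *\<^sub>R b k"] assms(2) sP by blast
  have "- (s h *\<^sub>R b h) \<notin> P"
  proof
    assume "- (s h *\<^sub>R b h) \<in> P"
    then have "s h *\<^sub>R b h \<in> neutral" using sP[of h] by (simp add: neutral_def)
    then have "s k0 *\<^sub>R b k0 \<in> neutral"
      using h(2)[OF assms(2)] sP[of k0] neutral_if_sandwiched by blast
    then show False using assms(3) by (auto simp: neutral_def s_def split: if_splits)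
  qed
  moreover have "\<exists>C. C *\<^sub>R (s h *\<^sub>R b h) - b k \<in> P \<and> C *\<^sub>R (s h *\<^sub>R b h) + b k \<in> P" if k: "k \<in> D" for k
  proof -
    obtain C where C: "C *\<^sub>R (s h *\<^sub>R b h) - s k *\<^sub>R b k \<in> P" using h(2)[OF k] by blast
    have "C *\<^sub>R (s h *\<^sub>R b h) - s k *\<^sub>R b k + (s k *\<^sub>R b k + s k *\<^sub>R b k) \<in> P"
      by (intro add C sP)
    then have "C *\<^sub>R (s h *\<^sub>R b h) + s k *\<^sub>R b k \<in> P" by simp
    then show ?thesis using C by (intro exI[of _ C]) (auto simp: s_def split: if_splits)
  qed
  moreover have "s h \<in> {1, -1}" by (simp add: s_def)
  ultimately show ?thesis using h(1) by blast
qed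

text \<open>
  Induction on the number of generators: \<open>h\<close> is a generator of the largest archimedean class and \<open>l k\<close>
  is the standard part of \<open>b k\<close> relative to it. The infinitesimal remainders \<open>b k - l k h\<close> are handled by
  induction on the part of \<open>K\<close> where the standard part vanishes, and a large multiple of the standard
  part takes care of the rest of \<open>K\<close>.
\<close>

lemma separating_functional:
  fixes b :: "'k \<Rightarrow> 'a" and c :: "'k \<Rightarrow> 'x::topological_space \<Rightarrow> real"
  assumes "finite D" "compact K" "\<And>k. k \<in> D \<Longrightarrow> continuous_on K (c k)"
    and "\<And>x. x \<in> K \<Longrightarrow> - (\<Sum>k\<in>D. c k x *\<^sub>R b k) \<notin> P"
  shows "\<exists>f. (\<forall>x\<in>K. 0 < (\<Sum>k\<in>D. c k x * f k)) \<and>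
    (\<forall>r. (\<Sum>k\<in>D. r k *\<^sub>R b k) \<in> neutral \<longrightarrow> (\<Sum>k\<in>D. r k * f k) = 0)"
  using assms
proof (induction "card D" arbitrary: D b K rule: less_induct)
  case less
  show ?case
  proof (cases "\<forall>k\<in>D. b k \<in> neutral")
    case True
    have "(\<Sum>k\<in>D. r k *\<^sub>R b k) \<in> neutral" for r
      using True subspace_neutral by (intro subspace_sum subspace_scale) auto
    then have "K = {}" using less.prems(4) by (auto simp: neutral_def)
    then show ?thesis by (intro exI[of _ "\<lambda>_. 0"]) auto
  next
    case False
    then obtain k0 where "k0 \<in> D" "b k0 \<notin> neutral" by blast
    then obtain h s where h: "h \<in> D" "s = 1 \<or> s = -1" "- (s *\<^sub>R b h) \<notin> P"
      and dom: "\<And>k. k \<in> D \<Longrightarrow> \<exists>C. C *\<^sub>R (s *\<^sub>R b h) - b k \<in> P \<and> C *\<^sub>R (s *\<^sub>R b h) + b k \<in> P"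
      using dominant_element[OF less.prems(1)] by (metis insertE singletonD)
    define H where "H = s *\<^sub>R b h"
    have HP: "H \<in> P" "- H \<notin> P" using h(3) total[of H] by (auto simp: H_def)
    have "\<forall>k\<in>D. \<exists>l. \<forall>e>0. (l + e) *\<^sub>R H - b k \<in> P \<and> b k - (l - e) *\<^sub>R H \<in> P"
      using standard_part_exists HP(2) dom unfolding H_def by blast
    then obtain l0 where l0: "\<And>k e. k \<in> D \<Longrightarrow> 0 < e \<Longrightarrow> (l0 k + e) *\<^sub>R H - b k \<in> P"
       "\<And>k e. k \<in> D \<Longrightarrow> 0 < e \<Longrightarrow> b k - (l0 k - e) *\<^sub>R H \<in> P"
      by metis
    \<comment> \<open>Since \<open>b h = s *\<^sub>R H\<close>, prescribing \<open>s\<close> makes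
      the remainder at \<open>h\<close> exactly 0, so \<open>h\<close> drops out of the
      induction.\<close>
    define l where "l = l0(h := s)"
    have ss: "s * s = 1" using h(2) by auto
    have bh: "b h = s *\<^sub>R H" using ss by (simp add: H_def)
    have l: "(l k + e) *\<^sub>R H - b k \<in> P" "b k - (l k - e) *\<^sub>R H \<in> P" if "k \<in> D" "0 < e" for k e
      using l0[OF that] that HP(1) scale[of e H]
      by (cases "k = h"; simp add: l_def bh algebra_simps)+
    define v where "v r = (\<Sum>k\<in>D. r k *\<^sub>R b k)" for r
    define \<Lambda> where "\<Lambda> r = (\<Sum>k\<in>D. r k * l k)" for r :: "'k \<Rightarrow> real"
    have v_minus: "v (\<lambda>k. - r k) = - v r" for r
      by (simp add: v_def sum_negf)
    have \<Lambda>_minus: "\<Lambda> (\<lambda>k. - r k) = - \<Lambda> r" for r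
      by (simp add: \<Lambda>_def sum_negf)
    \<comment> \<open>One half of the fact that \<open>\<Lambda> r\<close> is the standard part of
      \<open>v r\<close>: the errors of the single generators add up to an arbitrarily small
      multiple of \<open>H\<close>.\<close>
    have upper: "(\<Lambda> r + (\<Sum>k\<in>D. \<bar>r k\<bar>) * e) *\<^sub>R H - v r \<in> P" if "0 < e" for r e
    proof -
      have "(r k * l k + \<bar>r k\<bar> * e) *\<^sub>R H - r k *\<^sub>R b k \<in> P" if "k \<in> D" for k
      proof (cases "0 \<le> r k")
        case True
        then show ?thesis
          using scale[OF True l(1)[OF that \<open>0 < e\<close>]] by (simp add: algebra_simps)
      next
        case False
        then show ?thesis
          using scale[OF _ l(2)[OF that \<open>0 < e\<close>], of "- r k"] by (simp add: algebra_simps)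
      qed
      then have "(\<Sum>k\<in>D. (r k * l k + \<bar>r k\<bar> * e) *\<^sub>R H - r k *\<^sub>R b k) \<in> P"
        by (induction D rule: infinite_finite_induct) (auto intro: add)
      then show ?thesis
        by (simp add: \<Lambda>_def v_def sum_subtractf sum.distrib sum_distrib_right flip: scaleR_sum_left)
    qed
    have \<Lambda>_nonneg: "0 \<le> \<Lambda> r" if "v r \<in> P" for r
    proof (rule ccontr)
      assume neg: "\<not> 0 \<le> \<Lambda> r"
      define R where "R = (\<Sum>k\<in>D. \<bar>r k\<bar>)"
      have R: "0 \<le> R" by (simp add: R_def sum_nonneg)
      \<comment> \<open>Chosen so that \<open>R * e\<close> is at most half of
        \<open>- \<Lambda> r\<close>; the \<open>+ 1\<close> keeps the denominator positive.\<close>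
      define e where "e = - \<Lambda> r / (2 * (R + 1))"
      have e: "0 < e" unfolding e_def using neg R by (intro divide_pos_pos) auto
      have "\<Lambda> r + R * e < 0"
      proof -
        have "R * e = - \<Lambda> r / 2 * (R / (R + 1))" using R by (simp add: e_def field_simps)
        also have "\<dots> \<le> - \<Lambda> r / 2 * 1" using neg R by (intro mult_left_mono) auto
        finally show ?thesis using neg by linarith
      qed
      moreover have "(\<Lambda> r + R * e) *\<^sub>R H - v r + v r \<in> P"
        using upper[OF e, of r] that unfolding R_def by (rule add)
      ultimately show False using negative_multiple[OF HP(2), of "\<Lambda> r + R * e"] by simp
    qed
    define D' where "D' = D - {h}"
    define b' where "b' k = b k - l k *\<^sub>R H" for k
    have v': "(\<Sum>k\<in>D'. r k *\<^sub>R b' k) = v r - \<Lambda> r *\<^sub>R H" for r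
    proof -
      have "(\<Sum>k\<in>D'. r k *\<^sub>R b' k) = (\<Sum>k\<in>D. r k *\<^sub>R b' k)"
        unfolding D'_def using sum.remove[OF less.prems(1) h(1), of "\<lambda>k. r k *\<^sub>R b' k"]
        by (simp add: b'_def[of h] l_def bh)
      then show ?thesis
        by (simp add: b'_def v_def \<Lambda>_def algebra_simps sum_subtractf scaleR_sum_left)
    qed
    \<comment> \<open>On \<open>K'\<close> the combination of the remainders equals the original one
      by \<open>v'\<close>, so the strict positivity hypothesis passes to \<open>D'\<close> and
      \<open>b'\<close>.\<close>
    define K' where "K' = K \<inter> (\<lambda>x. \<Lambda> (\<lambda>k. c k x)) -` {0}"
    have cont: "continuous_on K (\<lambda>x. \<Lambda> (\<lambda>k. c k x))"
      unfolding \<Lambda>_def using less.prems(3) by (intro continuous_intros)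
    have "closedin (top_of_set K) K'"
      unfolding K'_def by (rule continuous_closedin_preimage[OF cont]) auto
    then have K': "compact K'"
      using less.prems(2) closedin_compact by blast
    have "card D' < card D"
      unfolding D'_def using less.prems(1) h(1) by (rule card_Diff1_less)
    moreover have "finite D'" using less.prems(1) by (simp add: D'_def)
    moreover have "continuous_on K' (c k)" if "k \<in> D'" for k
      using less.prems(3)[of k] that by (auto simp: D'_def K'_def intro: continuous_on_subset)
    moreover have "- (\<Sum>k\<in>D'. c k x *\<^sub>R b' k) \<notin> P" if "x \<in> K'" for x
      using less.prems(4)[of x] that unfolding v' by (auto simp: K'_def v_def)
    ultimately obtain f' where f': "\<forall>x\<in>K'. 0 < (\<Sum>k\<in>D'. c k x * f' k)"
        "\<forall>r. (\<Sum>k\<in>D'. r k *\<^sub>R b' k) \<in> neutral \<longrightarrow> (\<Sum>k\<in>D'. r k * f' k) = 0"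
      using less.hyps[of D' K' b'] K' by blast
    have "\<exists>t. \<forall>x\<in>K. 0 < t * \<Lambda> (\<lambda>k. c k x) + (\<Sum>k\<in>D'. c k x * f' k)"
    proof (rule compact_penalty[OF less.prems(2) cont])
      show "continuous_on K (\<lambda>x. \<Sum>k\<in>D'. c k x * f' k)"
        using less.prems(3) by (intro continuous_intros) (auto simp: D'_def)
      fix x assume x: "x \<in> K"
      show "0 \<le> \<Lambda> (\<lambda>k. c k x)"
        using less.prems(4)[OF x] total[of "v (\<lambda>k. c k x)"]
        by (intro \<Lambda>_nonneg) (auto simp: v_def)
      show "0 < (\<Sum>k\<in>D'. c k x * f' k)" if "\<Lambda> (\<lambda>k. c k x) = 0"
        using x that f'(1) by (simp add: K'_def)
    qed
    then obtain t where t: "\<And>x. x \<in> K \<Longrightarrow> 0 < t * \<Lambda> (\<lambda>k. c k x) + (\<Sum>k\<in>D'. c k x * f' k)"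
      by blast
    define f where "f k = t * l k + (f'(h := 0)) k" for k
    have f: "(\<Sum>k\<in>D. r k * f k) = t * \<Lambda> r + (\<Sum>k\<in>D'. r k * f' k)" for r
    proof -
      have "(\<Sum>k\<in>D. r k * (f'(h := 0)) k) = (\<Sum>k\<in>D'. r k * (f'(h := 0)) k)"
        unfolding D'_def
        using sum.remove[OF less.prems(1) h(1), of "\<lambda>k. r k * (f'(h := 0)) k"] by simp
      also have "\<dots> = (\<Sum>k\<in>D'. r k * f' k)"
        by (rule sum.cong) (auto simp: D'_def)
      finally show ?thesis
        by (simp add: f_def \<Lambda>_def distrib_left sum.distrib sum_distrib_left mult.left_commute)
    qed
    have "(\<Sum>k\<in>D. r k * f k) = 0" if "v r \<in> neutral" for r
    proof -
      \<comment> \<open>Both \<open>v r\<close> and its negative are in \<open>P\<close>, so the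
        standard part vanishes; then \<open>v r\<close> is the combination of remainders, which
        \<open>f'\<close> kills.\<close>
      have "0 \<le> \<Lambda> r" using that by (intro \<Lambda>_nonneg) (auto simp: neutral_def)
      moreover have "0 \<le> \<Lambda> (\<lambda>k. - r k)"
        using that by (intro \<Lambda>_nonneg) (auto simp: neutral_def v_minus)
      ultimately have "\<Lambda> r = 0" by (simp add: \<Lambda>_minus)
      then show ?thesis using that f'(2) by (simp add: f v')
    qed
    then show ?thesis using t by (intro exI[of _ f]) (auto simp: f v_def)
  qed
qed

end

section \<open>Maximal quadratic modules\<close>

locale quad_mod =
  fixes M :: "'a::{comm_ring_1, real_algebra_1} set"
  assumes square: "p\<^sup>2 \<in> M"
    and add: "v \<in> M \<Longrightarrow> w \<in> M \<Longrightarrow> v + w \<in> M"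
    and square_mult: "v \<in> M \<Longrightarrow> p\<^sup>2 * v \<in> M"
begin

lemma one: "1 \<in> M"
  using square[of 1] by simp

lemma scale:
  assumes "0 \<le> r" "v \<in> M"
  shows "r *\<^sub>R v \<in> M"
proof -
  have "(of_real (sqrt r))\<^sup>2 * v = r *\<^sub>R v"
    using assms(1) by (simp add: scaleR_conv_of_real flip: of_real_power)
  then show ?thesis using square_mult[OF assms(2)] by metis
qed

text \<open>By \<open>(p + 1)\<^sup>2 - (p - 1)\<^sup>2 = 4 * p\<close>, multiplication by any
  \<open>p\<close> is, up to a positive factor, a difference of multiplications by squares.\<close>

lemma support_ideal:
  assumes "v \<in> M" "- v \<in> M"
  shows "p * v \<in> M"
proof -
  have "(p + 1)\<^sup>2 * v + (p - 1)\<^sup>2 * (- v) \<in> M"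
    by (intro add square_mult assms)
  also have "(p + 1)\<^sup>2 * v + (p - 1)\<^sup>2 * (- v) = 4 *\<^sub>R (p * v)"
    by (simp add: scaleR_conv_of_real power2_eq_square algebra_simps)
  finally have "(1/4) *\<^sub>R (4 *\<^sub>R (p * v)) \<in> M" by (rule scale[rotated]) simp
  then show ?thesis by simp
qed

end

section \<open>Sums of squares and enlargements of a quadratic module\<close>

inductive_set sos :: "'a::comm_ring_1 set" where
  square: "p\<^sup>2 \<in> sos"
| add: "s \<in> sos \<Longrightarrow> t \<in> sos \<Longrightarrow> s + t \<in> sos"

lemma sos_square_mult: "s \<in> sos \<Longrightarrow> p\<^sup>2 * s \<in> sos"
  by (induction rule: sos.induct) (auto simp: distrib_left simp flip: power_mult_distrib intro: sos.intros)

lemma (in quad_mod) sos_mult: "s \<in> sos \<Longrightarrow> v \<in> M \<Longrightarrow> s * v \<in> M"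
  by (induction rule: sos.induct) (auto simp: distrib_right intro: add square_mult)

lemma (in quad_mod) sos_mem: "s \<in> sos \<Longrightarrow> s \<in> M"
  using sos_mult[OF _ one] by simp

lemma (in quad_mod) quad_mod_adjoin:
  "quad_mod {m + s * f | m s. m \<in> M \<and> s \<in> sos}"
proof
  fix p
  show "p\<^sup>2 \<in> {m + s * f | m s. m \<in> M \<and> s \<in> sos}"
    using square[of p] sos.square[of 0] by force
next
  fix v w p
  assume "v \<in> {m + s * f | m s. m \<in> M \<and> s \<in> sos}"
  then obtain m s where v: "v = m + s * f" "m \<in> M" "s \<in> sos" by blast
  have "p\<^sup>2 * v = p\<^sup>2 * m + (p\<^sup>2 * s) * f" by (simp add: v algebra_simps)
  then show "p\<^sup>2 * v \<in> {m + s * f | m s. m \<in> M \<and> s \<in> sos}"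
    using v square_mult sos_square_mult by blast
  assume "w \<in> {m + s * f | m s. m \<in> M \<and> s \<in> sos}"
  then obtain m' s' where w: "w = m' + s' * f" "m' \<in> M" "s' \<in> sos" by blast
  have "v + w = (m + m') + (s + s') * f" by (simp add: v w algebra_simps)
  then show "v + w \<in> {m + s * f | m s. m \<in> M \<and> s \<in> sos}"
    using v w add sos.add by blast
qed

lemma (in quad_mod) quad_mod_adjoin_ideal:
  "quad_mod {m + p * f | m p. m \<in> M}"
proof
  fix q
  show "q\<^sup>2 \<in> {m + p * f | m p. m \<in> M}"
    using square[of q] by (intro CollectI exI[of _ "q\<^sup>2"] exI[of _ 0]) auto
next
  fix v w q
  assume "v \<in> {m + p * f | m p. m \<in> M}"
  then obtain m p where v: "v = m + p * f" "m \<in> M" by blast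
  have "q\<^sup>2 * v = q\<^sup>2 * m + (q\<^sup>2 * p) * f" by (simp add: v algebra_simps)
  then show "q\<^sup>2 * v \<in> {m + p * f | m p. m \<in> M}"
    using v square_mult by blast
  assume "w \<in> {m + p * f | m p. m \<in> M}"
  then obtain m' p' where w: "w = m' + p' * f" "m' \<in> M" by blast
  have "v + w = (m + m') + (p + p') * f" by (simp add: v w algebra_simps)
  then show "v + w \<in> {m + p * f | m p. m \<in> M}"
    using v w add by blast
qed

locale maximal_quad_mod = quad_mod +
  assumes proper: "- 1 \<notin> M"
    and maximal: "quad_mod Q \<Longrightarrow> M \<subseteq> Q \<Longrightarrow> - 1 \<notin> Q \<Longrightarrow> Q = M"

text \<open>Zorn's lemma: any two elements of the union of a chain lie in one member, so the union
  is a quadratic module, and it omits \<open>- 1\<close> because each member does.\<close>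

lemma maximal_quad_mod_exists:
  assumes "quad_mod M" "- 1 \<notin> M"
  shows "\<exists>N. maximal_quad_mod N \<and> M \<subseteq> N"
proof -
  define \<A> where "\<A> = {Q. quad_mod Q \<and> M \<subseteq> Q \<and> - 1 \<notin> Q}"
  have "\<exists>N\<in>\<A>. \<forall>X\<in>\<A>. N \<subseteq> X \<longrightarrow> X = N"
  proof (rule subset_Zorn_nonempty)
    show "\<A> \<noteq> {}" using assms by (auto simp: \<A>_def)
    fix \<C> assume ne: "\<C> \<noteq> {}" and ch: "subset.chain \<A> \<C>"
    have Q: "quad_mod Q" "M \<subseteq> Q" "- 1 \<notin> Q" if "Q \<in> \<C>" for Q
      using ch that by (auto simp: subset.chain_def \<A>_def)
    have "quad_mod (\<Union>\<C>)"
    proof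
      fix p :: 'a show "p\<^sup>2 \<in> \<Union>\<C>" using ne Q(1) quad_mod.square by blast
    next
      fix v w p :: 'a
      assume v: "v \<in> \<Union>\<C>"
      then show "p\<^sup>2 * v \<in> \<Union>\<C>" using Q(1) quad_mod.square_mult by blast
      assume w: "w \<in> \<Union>\<C>"
      obtain X Y where XY: "X \<in> \<C>" "v \<in> X" "Y \<in> \<C>" "w \<in> Y" using v w by blast
      then have "X \<subseteq> Y \<or> Y \<subseteq> X" using ch by (auto simp: subset.chain_def)
      then obtain Z where "Z \<in> \<C>" "v \<in> Z" "w \<in> Z" using XY by blast
      then show "v + w \<in> \<Union>\<C>" using Q(1) quad_mod.add by blast
    qed
    moreover have "M \<subseteq> \<Union>\<C>" using Q(2) ne by blast
    ultimately show "\<Union>\<C> \<in> \<A>" using Q(3) by (auto simp: \<A>_def)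
  qed
  then obtain N where N: "N \<in> \<A>" "\<And>X. X \<in> \<A> \<Longrightarrow> N \<subseteq> X \<Longrightarrow> X = N" by blast
  have "maximal_quad_mod N"
    using N unfolding maximal_quad_mod_def maximal_quad_mod_axioms_def \<A>_def by blast
  then show ?thesis using N(1) by (auto simp: \<A>_def)
qed

context maximal_quad_mod
begin

lemma adjoin_witness:
  assumes "f \<notin> M"
  obtains m s where "m \<in> M" "s \<in> sos" "- 1 = m + s * f"
proof -
  let ?Q = "{m + s * f | m s. m \<in> M \<and> s \<in> sos}"
  have "m = m + 0\<^sup>2 * f" for m by simp
  then have "M \<subseteq> ?Q" using sos.square by blast
  moreover have "f = 0\<^sup>2 + 1\<^sup>2 * f" by simp
  then have "f \<in> ?Q" using sos.square square by blast
  ultimately have "- 1 \<in> ?Q" using maximal[OF quad_mod_adjoin] assms by blast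
  then show ?thesis using that by blast
qed

text \<open>Adjoining the whole ideal of \<open>f\<close> strictly enlarges \<open>M\<close> unless
  \<open>f\<close> is in the support, so by maximality the result contains
  \<open>- 1\<close>.\<close>

lemma adjoin_ideal_witness:
  assumes "\<not> (f \<in> M \<and> - f \<in> M)"
  obtains m p where "m \<in> M" "- 1 = m + p * f"
proof -
  let ?Q = "{m + p * f | m p. m \<in> M}"
  have "m = m + 0 * f" for m by simp
  then have "M \<subseteq> ?Q" by blast
  moreover have "f = 0\<^sup>2 + 1 * f" "- f = 0\<^sup>2 + (- 1) * f" by simp_all
  then have "f \<in> ?Q" "- f \<in> ?Q" using square by blast+
  ultimately have "- 1 \<in> ?Q" using maximal[OF quad_mod_adjoin_ideal] assms by blast
  then show ?thesis using that by blast
qed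

lemma total: "f \<in> M \<or> - f \<in> M"
proof (rule ccontr)
  assume "\<not> ?thesis"
  then have f: "f \<notin> M" "- f \<notin> M" by auto
  obtain m s where m: "m \<in> M" "s \<in> sos" "- 1 = m + s * f" using adjoin_witness[OF f(1)] .
  obtain n t where n: "n \<in> M" "t \<in> sos" "- 1 = n + t * (- f)" using adjoin_witness[OF f(2)] .
  have sf: "s * f = - 1 - m" by (subst m(3)) simp
  have tf: "t * f = n - (- 1)" by (subst n(3)) simp
  \<comment> \<open>Multiplying the witnesses crosswise eliminates \<open>f\<close> and shows
    \<open>- t \<in> M\<close>. As \<open>t\<close> is a sum of squares it lies in the support,
    which is an ideal, so \<open>t * (- f)\<close> is in \<open>M\<close> and then so is
    \<open>- 1\<close>.\<close>
  have "t * (s * f) = s * (t * f)" by (simp add: mult.left_commute)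
  then have "- t = s + (s * n + t * m)" unfolding sf tf by (simp add: algebra_simps)
  moreover have "s + (s * n + t * m) \<in> M" by (intro add sos_mult sos_mem m n)
  ultimately have "t \<in> M" "- t \<in> M" using sos_mem[OF n(2)] by simp_all
  then have "- f * t \<in> M" by (rule support_ideal)
  then have "n + t * (- f) \<in> M" using n(1) by (intro add) (simp_all add: mult.commute)
  then show False using n(3) proper by simp
qed

sublocale total_cone M
  by unfold_locales (fact add, fact scale, fact total)

lemma neutral_mult: "v \<in> neutral \<Longrightarrow> p * v \<in> neutral"
  using support_ideal[of v p] support_ideal[of v "- p"] by (auto simp: neutral_def)

text \<open>
  If \<open>b\<close> were not in the support, then \<open>-1 - pb \<in> M\<close> for some \<open>p\<close>, and adding \<open>q\<^sup>2(-1 - pb)\<close> to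
  \<open>pq\<^sup>2b + c\<close> gives \<open>c - q\<^sup>2 \<in> M\<close> for every \<open>q\<close>; the choice \<open>q = c/2 + 1\<close> leads to \<open>-1 \<in> M\<close>.
\<close>

lemma neutral_if_form_nonneg:
  assumes a: "a \<in> neutral" and form: "\<And>p r. p\<^sup>2 * a + 2 * p * r * b + r\<^sup>2 * c \<in> M"
  shows "b \<in> neutral"
proof (rule ccontr)
  assume "b \<notin> neutral"
  then obtain m p where m: "m \<in> M" "- 1 = m + p * b"
    using adjoin_ideal_witness[of b] by (auto simp: neutral_def)
  define d where "d = (1/2) *\<^sub>R c"
  define q where "q = d + 1"
  define p' where "p' = (1/2) *\<^sub>R (p * q\<^sup>2)"
  have "- ((p')\<^sup>2 * a) \<in> M" using neutral_mult[OF a] by (simp add: neutral_def)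
  from add[OF form[of p' 1] this] have "2 * p' * b + c \<in> M" by simp
  moreover have "2 * p' = (1/2 + 1/2) *\<^sub>R (p * q\<^sup>2)"
    unfolding p'_def mult_2 by (rule scaleR_add_left[symmetric])
  ultimately have pb: "p * q\<^sup>2 * b + c \<in> M" by simp
  have "q\<^sup>2 * m + (p * q\<^sup>2 * b + c) + d\<^sup>2 \<in> M"
    by (rule add[OF add[OF square_mult[OF m(1)] pb] square])
  moreover have "m = - 1 - p * b" using m(2) by (simp add: algebra_simps)
  ultimately have "- (q\<^sup>2) + c + d\<^sup>2 \<in> M" by (simp add: algebra_simps)
  also have "- (q\<^sup>2) + c + d\<^sup>2 = - 1"
  proof -
    have "c = d + d" by (simp add: d_def flip: scaleR_add_left)
    then show ?thesis by (simp add: q_def power2_eq_square algebra_simps)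
  qed
  finally show False using proper by simp
qed

end

section \<open>Quadratic forms over a maximal quadratic module\<close>

text \<open>Index functions instead of matrices let the same bilinear form serve for polynomial
  entries and for real coefficients; only indices below \<open>m\<close> are read.\<close>

definition form :: "nat \<Rightarrow> (nat \<Rightarrow> nat \<Rightarrow> 'a::comm_ring_1) \<Rightarrow> (nat \<Rightarrow> 'a) \<Rightarrow> (nat \<Rightarrow> 'a) \<Rightarrow> 'a" where
  "form m a v w = (\<Sum>i<m. \<Sum>j<m. v i * w j * a i j)"

lemma form_add_left: "form m a (\<lambda>i. u i + v i) w = form m a u w + form m a v w"
  by (simp add: form_def sum.distrib algebra_simps)

lemma form_mult_left: "form m a (\<lambda>i. p * v i) w = p * form m a v w"
  by (simp add: form_def sum_distrib_left algebra_simps)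

lemma form_mult_both: "form m a (\<lambda>i. p * v i) (\<lambda>i. p * v i) = p\<^sup>2 * form m a v v"
  by (simp add: form_def sum_distrib_left power2_eq_square algebra_simps)

lemma form_commute:
  assumes "\<And>i j. i < m \<Longrightarrow> j < m \<Longrightarrow> a i j = a j i"
  shows "form m a v w = form m a w v"
proof -
  have "form m a v w = (\<Sum>j<m. \<Sum>i<m. v i * w j * a i j)"
    unfolding form_def by (rule sum.swap)
  also have "\<dots> = form m a w v"
    unfolding form_def using assms by (intro sum.cong) (auto simp: mult.commute)
  finally show ?thesis .
qed

lemma form_combination:
  assumes "\<And>i j. i < m \<Longrightarrow> j < m \<Longrightarrow> a i j = a j i"
  shows "form m a (\<lambda>i. p * u i + r * w i) (\<lambda>i. p * u i + r * w i) =
    p\<^sup>2 * form m a u u + 2 * p * r * form m a u w + r\<^sup>2 * form m a w w"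
proof -
  have right: "form m a x (\<lambda>i. p * u i + r * w i) = p * form m a x u + r * form m a x w" for x
  proof -
    have "form m a x (\<lambda>i. p * u i + r * w i) = form m a (\<lambda>i. p * u i + r * w i) x"
      by (rule form_commute[OF assms])
    then show ?thesis
      using form_commute[OF assms, where v = u and w = x] form_commute[OF assms, where v = w and w = x]
      by (simp add: form_add_left form_mult_left)
  qed
  show ?thesis
    using form_commute[OF assms, where v = w and w = u]
    by (simp add: form_add_left form_mult_left right power2_eq_square algebra_simps)
qed

text \<open>Isotropic vectors of a semidefinite form lie in its kernel, here modulo the support.
  Expanding the form at a combination of \<open>u\<close> and \<open>w\<close> yields the binary
  form required by \<open>neutral_if_form_nonneg\<close>.\<close>

lemma (in maximal_quad_mod) form_kernel:
  assumes "\<And>i j. i < m \<Longrightarrow> j < m \<Longrightarrow> a i j = a j i" "\<And>v. form m a v v \<in> M"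
    and "form m a u u \<in> neutral"
  shows "form m a u w \<in> neutral"
  using assms(3)
proof (rule neutral_if_form_nonneg)
  fix p r
  show "p\<^sup>2 * form m a u u + 2 * p * r * form m a u w + r\<^sup>2 * form m a w w \<in> M"
    using assms(2) by (simp flip: form_combination[OF assms(1)])
qed

section \<open>From the maximal module to a real functional\<close>

lemma compact_coordinate_sphere:
  assumes "finite S"
  shows "compact {u :: 'i \<Rightarrow> real. (\<forall>i. i \<notin> S \<longrightarrow> u i = 0) \<and> (\<Sum>i\<in>S. (u i)\<^sup>2) = 1}"
proof -
  let ?B = "PiE UNIV (\<lambda>i. if i \<in> S then {-1..1} else {0}) :: ('i \<Rightarrow> real) set"
  have coord [continuous_intros]: "continuous_on UNIV (\<lambda>u :: 'i \<Rightarrow> real. u i)" for i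
    by simp
  have "compactin (product_topology (\<lambda>i. euclidean) UNIV) ?B"
    unfolding compactin_PiE by auto
  then have B: "compact ?B"
    by (simp add: euclidean_product_topology)
  have "closed {u :: 'i \<Rightarrow> real. (\<Sum>i\<in>S. (u i)\<^sup>2) = 1}"
    by (intro closed_Collect_eq continuous_intros)
  with B have "compact (?B \<inter> {u. (\<Sum>i\<in>S. (u i)\<^sup>2) = 1})"
    by (rule compact_Int_closed)
  also have "?B \<inter> {u. (\<Sum>i\<in>S. (u i)\<^sup>2) = 1} =
    {u. (\<forall>i. i \<notin> S \<longrightarrow> u i = 0) \<and> (\<Sum>i\<in>S. (u i)\<^sup>2) = 1}"
  proof (intro equalityI subsetI)
    fix u :: "'i \<Rightarrow> real"
    assume u: "u \<in> {u. (\<forall>i. i \<notin> S \<longrightarrow> u i = 0) \<and> (\<Sum>i\<in>S. (u i)\<^sup>2) = 1}"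
    have "\<bar>u i\<bar> \<le> 1" if "i \<in> S" for i
    proof -
      have "(u i)\<^sup>2 \<le> 1"
        using member_le_sum[OF that, of "\<lambda>i. (u i)\<^sup>2"] assms u by simp
      then show ?thesis by (simp add: abs_square_le_1)
    qed
    then show "u \<in> ?B \<inter> {u. (\<Sum>i\<in>S. (u i)\<^sup>2) = 1}" using u by (auto simp: abs_le_iff)
  next
    fix u :: "'i \<Rightarrow> real"
    assume u: "u \<in> ?B \<inter> {u. (\<Sum>i\<in>S. (u i)\<^sup>2) = 1}"
    have "u i = 0" if "i \<notin> S" for i
      using PiE_mem[OF IntD1[OF u] UNIV_I, of i] that by simp
    then show "u \<in> {u. (\<forall>i. i \<notin> S \<longrightarrow> u i = 0) \<and> (\<Sum>i\<in>S. (u i)\<^sup>2) = 1}"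
      using u by simp
  qed
  finally show ?thesis .
qed

text \<open>\<open>f\<close> lists the values of a linear functional at the \<open>b k\<close>. On a
  maximal set of coordinates where only the zero vector has a neutral value, compactness of the
  sphere yields the functional; the other coordinates are eliminated by kernel vectors.\<close>

lemma (in maximal_quad_mod) real_point_exists:
  fixes coef :: "'k \<Rightarrow> nat \<Rightarrow> nat \<Rightarrow> real"
  assumes D: "finite D" "k0 \<in> D" "b k0 = 1"
    and a: "\<And>i j. a i j = (\<Sum>k\<in>D. coef k i j *\<^sub>R b k)"
    and sym: "\<And>k i j. i < m \<Longrightarrow> j < m \<Longrightarrow> coef k i j = coef k j i"
    and nonneg: "\<And>v. form m a v v \<in> M"
  shows "\<exists>f. f k0 = 1 \<and> (\<forall>u. 0 \<le> (\<Sum>k\<in>D. f k * form m (coef k) u u))"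
proof -
  have a_sym: "a i j = a j i" if "i < m" "j < m" for i j
    using sym[OF that] by (simp add: a)
  define q where "q u w = form m a (\<lambda>i. of_real (u i)) (\<lambda>i. of_real (w i))" for u w
  have q: "q u w = (\<Sum>k\<in>D. form m (coef k) u w *\<^sub>R b k)" for u w
  proof -
    have "q u w = (\<Sum>i<m. \<Sum>j<m. \<Sum>k\<in>D. (u i * w j * coef k i j) *\<^sub>R b k)"
      by (simp add: q_def form_def a sum_distrib_left scaleR_conv_of_real mult.assoc)
    also have "\<dots> = (\<Sum>i<m. \<Sum>k\<in>D. \<Sum>j<m. (u i * w j * coef k i j) *\<^sub>R b k)"
      by (intro sum.cong refl sum.swap)
    also have "\<dots> = (\<Sum>k\<in>D. \<Sum>i<m. \<Sum>j<m. (u i * w j * coef k i j) *\<^sub>R b k)"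
      by (rule sum.swap)
    finally show ?thesis by (simp add: form_def scaleR_sum_left)
  qed
  have q_nonneg: "q u u \<in> M" for u
    by (simp add: q_def nonneg)
  have q_scale: "q (\<lambda>i. r * u i) (\<lambda>i. r * u i) = r\<^sup>2 *\<^sub>R q u u" for r u
    by (simp add: q form_mult_both scaleR_sum_right)
  \<comment> \<open>For such \<open>J\<close> the form is strictly positive at nonzero real vectors
    supported in \<open>J\<close>; the empty set qualifies, so a maximal \<open>J\<close>
    exists.\<close>
  define indep where "indep J \<longleftrightarrow>
    (\<forall>u. (\<forall>i. i \<notin> J \<longrightarrow> u i = 0) \<longrightarrow> q u u \<in> neutral \<longrightarrow> u = (\<lambda>_. 0))" for J
  have "finite {J. J \<subseteq> {..<m} \<and> indep J}" "{J. J \<subseteq> {..<m} \<and> indep J} \<noteq> {}"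
    by (auto simp: indep_def intro!: exI[of _ "{}"])
  from finite_has_maximal[OF this] obtain J
    where "J \<in> {J. J \<subseteq> {..<m} \<and> indep J}"
      and "\<forall>J'\<in>{J. J \<subseteq> {..<m} \<and> indep J}. J \<subseteq> J' \<longrightarrow> J = J'"
    by (elim bexE)
  then have J: "J \<subseteq> {..<m}" "indep J"
    and J_max: "\<And>J'. J' \<subseteq> {..<m} \<Longrightarrow> indep J' \<Longrightarrow> J \<subseteq> J' \<Longrightarrow> J = J'"
    by simp_all
  have fin: "finite J" and mJ: "m \<notin> J"
    using J(1) finite_subset by auto
  \<comment> \<open>The extra coordinate \<open>m\<close> adds the diagonal entry \<open>1\<close> to the pencil, which forces \<open>f k0 > 0\<close>.\<close>
  define K where "K = {u :: nat \<Rightarrow> real.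
    (\<forall>i. i \<notin> insert m J \<longrightarrow> u i = 0) \<and> (\<Sum>i\<in>insert m J. (u i)\<^sup>2) = 1}"
  define c where "c k u = form m (coef k) u u + (if k = k0 then (u m)\<^sup>2 else 0)" for k u
  have c_sum: "(\<Sum>k\<in>D. c k u *\<^sub>R b k) = q u u + (u m)\<^sup>2 *\<^sub>R 1" for u
  proof -
    have "(\<Sum>k\<in>D. (if k = k0 then (u m)\<^sup>2 else 0) *\<^sub>R b k) =
        (\<Sum>k\<in>D. if k = k0 then (u m)\<^sup>2 *\<^sub>R b k else 0)"
      by (rule sum.cong) auto
    then show ?thesis using D by (simp add: c_def q scaleR_add_left sum.distrib)
  qed
  have "- (\<Sum>k\<in>D. c k u *\<^sub>R b k) \<notin> M" if u: "u \<in> K" for u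
  proof
    assume neg: "- (\<Sum>k\<in>D. c k u *\<^sub>R b k) \<in> M"
    from add[OF this q_nonneg[of u]] have "(u m)\<^sup>2 *\<^sub>R (- 1) \<in> M"
      by (simp add: c_sum)
    then have "(u m)\<^sup>2 = 0"
      using negative_multiple[of 1 "- ((u m)\<^sup>2)"] proper by simp
    moreover from this have "q u u \<in> neutral"
      using neg q_nonneg[of u] by (simp add: c_sum neutral_def)
    moreover have "\<forall>i. i \<notin> J \<longrightarrow> u i = 0"
      using u \<open>(u m)\<^sup>2 = 0\<close> by (auto simp: K_def)
    ultimately have "u = (\<lambda>_. 0)" using J(2) by (simp add: indep_def)
    then show False using u by (simp add: K_def)
  qed
  moreover have "continuous_on K (c k)" for k
  proof -
    have coord [continuous_intros]: "continuous_on K (\<lambda>u. u i)" for i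
      by (rule continuous_on_subset[OF continuous_on_product_coordinates]) simp
    show ?thesis
      unfolding c_def form_def by (cases "k = k0") (auto intro!: continuous_intros)
  qed
  moreover have "compact K"
    unfolding K_def using fin by (intro compact_coordinate_sphere) simp
  ultimately obtain f where f: "\<And>u. u \<in> K \<Longrightarrow> 0 < (\<Sum>k\<in>D. c k u * f k)"
    and f_neutral: "\<And>r. (\<Sum>k\<in>D. r k *\<^sub>R b k) \<in> neutral \<Longrightarrow> (\<Sum>k\<in>D. r k * f k) = 0"
    using separating_functional[OF D(1), of K c b] by blast
  define Q where "Q u w = (\<Sum>k\<in>D. form m (coef k) u w * f k)" for u w
  have c_f: "(\<Sum>k\<in>D. c k u * f k) = Q u u + (u m)\<^sup>2 * f k0" for u
  proof -
    have "(\<Sum>k\<in>D. (if k = k0 then (u m)\<^sup>2 else 0) * f k) =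
        (\<Sum>k\<in>D. if k = k0 then (u m)\<^sup>2 * f k else 0)"
      by (rule sum.cong) auto
    then show ?thesis using D by (simp add: c_def Q_def distrib_right sum.distrib)
  qed
  have Q_comb: "Q (\<lambda>i. p * u i + r * w i) (\<lambda>i. p * u i + r * w i) =
      p\<^sup>2 * Q u u + 2 * p * r * Q u w + r\<^sup>2 * Q w w" for p r u w
    by (simp add: Q_def form_combination[OF sym] sum.distrib sum_distrib_left algebra_simps)
  have "0 < f k0"
  proof -
    \<comment> \<open>The unit vector of the extra coordinate is invisible to \<open>form m\<close>,
      so positivity on \<open>K\<close> reduces to \<open>0 < f k0\<close>.\<close>
    let ?e = "(\<lambda>_. 0)(m := 1) :: nat \<Rightarrow> real"
    have "(\<Sum>i\<in>J. (?e i)\<^sup>2) = 0" using mJ by (intro sum.neutral) auto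
    then have "?e \<in> K" using fin mJ by (simp add: K_def)
    moreover have "Q ?e ?e = 0"
      unfolding Q_def form_def by (intro sum.neutral ballI) simp
    ultimately show ?thesis using f[of ?e] by (simp add: c_f)
  qed
  have Q_J: "0 \<le> Q u u" if u: "\<And>i. i \<notin> J \<Longrightarrow> u i = 0" for u
  proof (cases "\<forall>i\<in>J. u i = 0")
    case True
    then have "u = (\<lambda>_. 0)" using u by auto
    then show ?thesis by (simp add: Q_def form_def)
  next
    case False
    define s where "s = (\<Sum>i\<in>J. (u i)\<^sup>2)"
    have s: "0 < s"
      using False fin unfolding s_def by (metis sum_pos2 zero_le_power2 zero_less_power2)
    define w where "w i = (1 / sqrt s) * u i" for i
    have "(\<Sum>i\<in>J. (w i)\<^sup>2) = 1"
      using s by (simp add: w_def power_divide s_def flip: sum_divide_distrib)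
    then have "w \<in> K" using u mJ fin by (auto simp: K_def w_def)
    then have "0 < Q w w" using f[of w] u[OF mJ] by (simp add: c_f w_def)
    moreover have "Q w w = (1 / sqrt s)\<^sup>2 * Q u u"
      unfolding w_def[abs_def] Q_def form_mult_both by (simp add: sum_distrib_left mult.assoc)
    ultimately show ?thesis using s by (simp add: power_divide zero_less_divide_iff)
  qed
  \<comment> \<open>By maximality of \<open>J\<close> some nonzero vector supported on
    \<open>insert i J\<close> has a neutral value; its entry at \<open>i\<close> is nonzero and can
    be scaled to 1. Then \<open>form_kernel\<close> puts \<open>q n w\<close> into the support,
    which \<open>f\<close> annihilates.\<close>
  have kernel: "\<exists>n. (\<forall>j. j \<notin> insert i J \<longrightarrow> n j = 0) \<and> n i = 1 \<and> (\<forall>w. Q n w = 0)"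
    if i: "i < m" "i \<notin> J" for i
  proof -
    have "\<not> indep (insert i J)"
      using J_max[of "insert i J"] J(1) i by blast
    then obtain u where u: "\<And>j. j \<notin> insert i J \<Longrightarrow> u j = 0" "q u u \<in> neutral" "u \<noteq> (\<lambda>_. 0)"
      by (auto simp: indep_def)
    have "u i \<noteq> 0"
    proof
      assume "u i = 0"
      then have "\<forall>j. j \<notin> J \<longrightarrow> u j = 0" using u(1) by (metis insertE)
      then show False using J(2) u(2,3) by (auto simp: indep_def)
    qed
    define n where "n j = (1 / u i) * u j" for j
    have "q n n \<in> neutral"
      using subspace_scale[OF subspace_neutral u(2)] q_scale[of "1 / u i" u]
      by (simp add: n_def[abs_def])
    then have "q n w \<in> neutral" for w
      unfolding q_def by (rule form_kernel[rotated 2]) (fact a_sym nonneg)+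
    then have "Q n w = 0" for w
      unfolding Q_def q by (rule f_neutral)
    then show ?thesis using u(1) \<open>u i \<noteq> 0\<close> by (intro exI[of _ n]) (auto simp: n_def)
  qed
  have Q_T: "0 \<le> Q u u" if "finite T" "T \<subseteq> {..<m} - J" "\<And>i. i \<notin> J \<union> T \<Longrightarrow> u i = 0" for T u
    using that
  proof (induction T arbitrary: u rule: finite_induct)
    case empty
    then show ?case by (intro Q_J) auto
  next
    case (insert i T)
    obtain n where n: "\<And>j. j \<notin> insert i J \<Longrightarrow> n j = 0" "n i = 1" "\<And>w. Q n w = 0"
      using kernel[of i] insert.prems(1) by auto
    \<comment> \<open>Subtracting \<open>u i\<close> times the kernel vector clears coordinate
      \<open>i\<close> and leaves \<open>Q\<close> unchanged.\<close>
    define w where "w j = 1 * u j + (- u i) * n j" for j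
    have "0 \<le> Q w w"
    proof (rule insert.IH)
      show "w j = 0" if "j \<notin> J \<union> T" for j
        using n(1)[of j] n(2) insert.prems(2)[of j] that by (cases "j = i") (auto simp: w_def)
    qed (use insert.prems in auto)
    moreover have "Q u n = Q n u"
      unfolding Q_def by (intro sum.cong refl arg_cong2[of _ _ _ _ "(*)"] form_commute sym)
    then have "Q u n = 0" by (simp only: n(3))
    then have "Q w w = Q u u"
      unfolding w_def[abs_def] Q_comb by (simp add: n(3))
    ultimately show ?case by simp
  qed
  have Q_all: "0 \<le> Q u u" for u
  proof -
    define w where "w i = (if i < m then u i else 0)" for i
    have "0 \<le> Q w w"
      by (rule Q_T[of "{..<m} - J"]) (use J(1) in \<open>auto simp: w_def\<close>)
    moreover have "Q w w = Q u u"
      by (simp add: Q_def form_def w_def)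
    ultimately show ?thesis by simp
  qed
  have "(\<Sum>k\<in>D. f k / f k0 * form m (coef k) u u) = Q u u / f k0" for u
    by (simp add: Q_def sum_divide_distrib mult.commute)
  then show ?thesis
    using Q_all \<open>0 < f k0\<close> by (intro exI[of _ "\<lambda>k. f k / f k0"]) simp
qed

section \<open>Real polynomials\<close>

lemma lookup_scaleR: "Poly_Mapping.lookup (r *\<^sub>R p) m = r *\<^sub>R Poly_Mapping.lookup p m"
proof -
  have "finite {i. r *\<^sub>R Poly_Mapping.lookup p i \<noteq> 0}"
    by (rule finite_subset[OF _ finite_lookup[of p]]) auto
  then show ?thesis by (simp add: scaleR_poly_mapping_def)
qed

text \<open>Lets \<open>quad_mod\<close> be used for polynomials. Real scaling is multiplication by
  a constant polynomial, so both laws reduce to ring laws.\<close>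

instance poly_mapping :: (comm_monoid_add, "{real_algebra_1, comm_ring_1}") real_algebra_1
proof
  fix a b :: "'a \<Rightarrow>\<^sub>0 'b" and r :: real
  have single: "r *\<^sub>R p = Poly_Mapping.single 0 (of_real r) * p" for p :: "'a \<Rightarrow>\<^sub>0 'b"
    by (rule poly_mapping_eqI)
      (simp add: lookup_scaleR map.rep_eq scaleR_conv_of_real when_def flip: mult_map_scale_conv_mult)
  show "r *\<^sub>R a * b = r *\<^sub>R (a * b)" by (simp add: single mult.assoc)
  show "a * r *\<^sub>R b = r *\<^sub>R (a * b)" by (simp add: single mult.left_commute)
qed

lemma sum_single_lookup:
  assumes "finite S" "Poly_Mapping.keys p \<subseteq> S"
  shows "(\<Sum>m\<in>S. Poly_Mapping.single m (Poly_Mapping.lookup p m)) = p"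
proof (rule poly_mapping_eqI)
  fix k
  have "(\<Sum>m\<in>S. Poly_Mapping.lookup p m when m = k) = Poly_Mapping.lookup p k"
    using assms by (auto simp: when_def not_in_keys_iff_lookup_eq_zero)
  then show "Poly_Mapping.lookup (\<Sum>m\<in>S. Poly_Mapping.single m (Poly_Mapping.lookup p m)) k =
      Poly_Mapping.lookup p k"
    by (simp add: lookup_sum lookup_single)
qed

text \<open>Both factors expand into monomials and additivity moves \<open>\<phi>\<close> into the
  double sum. It serves both evaluation and restriction of variables.\<close>

lemma multiplicative_if_on_singles:
  fixes \<phi> :: "real_poly \<Rightarrow> 'b::comm_ring_1"
  assumes add: "\<And>p q. \<phi> (p + q) = \<phi> p + \<phi> q"
    and single: "\<And>k l r s. \<phi> (Poly_Mapping.single (k + l) (r * s)) =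
      \<phi> (Poly_Mapping.single k r) * \<phi> (Poly_Mapping.single l s)"
  shows "\<phi> (p * q) = \<phi> p * \<phi> q"
proof -
  have zero: "\<phi> 0 = 0" using add[of 0 0] by simp
  have sum: "\<phi> (\<Sum>i\<in>I. f i) = (\<Sum>i\<in>I. \<phi> (f i))" for I :: "(nat \<Rightarrow>\<^sub>0 nat) set" and f
    by (induction I rule: infinite_finite_induct) (simp_all add: zero add)
  let ?s = "\<lambda>p m. Poly_Mapping.single m (Poly_Mapping.lookup p m)"
  have dec: "p = (\<Sum>m\<in>Poly_Mapping.keys p. ?s p m)" for p :: real_poly
    by (simp add: sum_single_lookup)
  have "p * q = (\<Sum>k\<in>Poly_Mapping.keys p. \<Sum>l\<in>Poly_Mapping.keys q. ?s p k * ?s q l)"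
    by (subst dec[of p], subst dec[of q]) (rule sum_product)
  then have "\<phi> (p * q) =
      (\<Sum>k\<in>Poly_Mapping.keys p. \<Sum>l\<in>Poly_Mapping.keys q. \<phi> (?s p k) * \<phi> (?s q l))"
    by (simp add: sum mult_single single)
  also have "\<dots> = \<phi> (\<Sum>k\<in>Poly_Mapping.keys p. ?s p k) * \<phi> (\<Sum>l\<in>Poly_Mapping.keys q. ?s q l)"
    by (simp add: sum sum_product)
  finally show ?thesis by (simp flip: dec)
qed

section \<open>Evaluation at a point\<close>

definition monomial_value :: "real vec \<Rightarrow> (nat \<Rightarrow>\<^sub>0 nat) \<Rightarrow> real" where
  "monomial_value x m = (\<Prod>i \<in> Poly_Mapping.keys m. (x $ i) ^ Poly_Mapping.lookup m i)"

lemma monomial_value_superset: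
  assumes "finite S" "Poly_Mapping.keys m \<subseteq> S"
  shows "monomial_value x m = (\<Prod>i\<in>S. (x $ i) ^ Poly_Mapping.lookup m i)"
  unfolding monomial_value_def
  using assms by (intro prod.mono_neutral_left) (auto simp: not_in_keys_iff_lookup_eq_zero)

lemma monomial_value_add: "monomial_value x (k + l) = monomial_value x k * monomial_value x l"
proof -
  let ?S = "Poly_Mapping.keys k \<union> Poly_Mapping.keys l"
  have "Poly_Mapping.keys (k + l) \<subseteq> ?S" by (rule keys_add)
  then show ?thesis
    by (simp add: monomial_value_superset[of ?S] lookup_add power_add prod.distrib)
qed

lemma eval_poly_superset:
  assumes "finite S" "Poly_Mapping.keys p \<subseteq> S"
  shows "eval_poly x p = (\<Sum>m\<in>S. Poly_Mapping.lookup p m * monomial_value x m)"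
  unfolding eval_poly_def monomial_value_def
  using assms by (intro sum.mono_neutral_left) (auto simp: not_in_keys_iff_lookup_eq_zero)

lemma eval_poly_add: "eval_poly x (p + q) = eval_poly x p + eval_poly x q"
proof -
  let ?S = "Poly_Mapping.keys p \<union> Poly_Mapping.keys q"
  have "Poly_Mapping.keys (p + q) \<subseteq> ?S" by (rule keys_add)
  then show ?thesis
    by (simp add: eval_poly_superset[of ?S] lookup_add distrib_right sum.distrib)
qed

lemma eval_poly_single: "eval_poly x (Poly_Mapping.single m r) = r * monomial_value x m"
  by (simp add: eval_poly_superset[of "{m}"])

lemma eval_poly_mult: "eval_poly x (p * q) = eval_poly x p * eval_poly x q"
  by (rule multiplicative_if_on_singles[OF eval_poly_add])
    (simp add: eval_poly_single monomial_value_add)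

lemma eval_poly_zero: "eval_poly x 0 = 0"
  by (simp add: eval_poly_def)

lemma eval_poly_one: "eval_poly x 1 = 1"
  by (simp add: eval_poly_def)

lemma eval_poly_uminus: "eval_poly x (- p) = - eval_poly x p"
  using eval_poly_add[of x p "- p"] by (simp add: eval_poly_zero)

lemma eval_poly_sum: "eval_poly x (\<Sum>i\<in>I. f i) = (\<Sum>i\<in>I. eval_poly x (f i))"
  by (induction I rule: infinite_finite_induct) (simp_all add: eval_poly_zero eval_poly_add)

lemma eval_poly_form:
  "eval_poly x (form m a v w) =
    form m (\<lambda>i j. eval_poly x (a i j)) (\<lambda>i. eval_poly x (v i)) (\<lambda>i. eval_poly x (w i))"
  by (simp add: form_def eval_poly_sum eval_poly_mult)

section \<open>Setting the variables from index \<open>n\<close> on to zero\<close>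

definition restrict_vars :: "nat \<Rightarrow> real_poly \<Rightarrow> real_poly" where
  "restrict_vars n p = (\<Sum>m\<in>{m \<in> Poly_Mapping.keys p. Poly_Mapping.keys m \<subseteq> {..<n}}.
     Poly_Mapping.single m (Poly_Mapping.lookup p m))"

lemma lookup_restrict_vars:
  "Poly_Mapping.lookup (restrict_vars n p) m =
    (if Poly_Mapping.keys m \<subseteq> {..<n} then Poly_Mapping.lookup p m else 0)"
  by (auto simp: restrict_vars_def lookup_sum lookup_single when_def not_in_keys_iff_lookup_eq_zero)

lemma restrict_vars_in_polys: "restrict_vars n p \<in> polys n"
proof -
  have "Poly_Mapping.keys m \<subseteq> {..<n}" if "m \<in> Poly_Mapping.keys (restrict_vars n p)" for m
  proof -
    from that have "Poly_Mapping.lookup (restrict_vars n p) m \<noteq> 0" by (simp add: in_keys_iff)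
    then show ?thesis by (simp add: lookup_restrict_vars split: if_splits)
  qed
  then show ?thesis by (simp add: polys_def)
qed

lemma restrict_vars_id: "p \<in> polys n \<Longrightarrow> restrict_vars n p = p"
  by (rule poly_mapping_eqI) (auto simp: lookup_restrict_vars polys_def in_keys_iff)

lemma restrict_vars_add: "restrict_vars n (p + q) = restrict_vars n p + restrict_vars n q"
  by (rule poly_mapping_eqI) (simp add: lookup_restrict_vars lookup_add)

text \<open>Natural exponents cannot cancel, hence equality in place of an inclusion.\<close>

lemma keys_add_nat:
  "Poly_Mapping.keys (k + l) = Poly_Mapping.keys k \<union> Poly_Mapping.keys (l :: 'b \<Rightarrow>\<^sub>0 nat)"
  by (auto simp: in_keys_iff lookup_add)

lemma restrict_vars_single:
  "restrict_vars n (Poly_Mapping.single m r) =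
    (if Poly_Mapping.keys m \<subseteq> {..<n} then Poly_Mapping.single m r else 0)"
  by (rule poly_mapping_eqI) (auto simp: lookup_restrict_vars lookup_single when_def)

text \<open>A product of monomials involves only variables below \<open>n\<close> exactly if both
  factors do, so killing all other monomials respects products.\<close>

lemma restrict_vars_mult: "restrict_vars n (p * q) = restrict_vars n p * restrict_vars n q"
  by (rule multiplicative_if_on_singles[OF restrict_vars_add])
    (auto simp: restrict_vars_single keys_add_nat mult_single)

lemma restrict_vars_sum: "restrict_vars n (\<Sum>i\<in>I. f i) = (\<Sum>i\<in>I. restrict_vars n (f i))"
  by (induction I rule: infinite_finite_induct)
    (simp_all add: restrict_vars_add, simp_all add: restrict_vars_def)

section \<open>Sums of squares and quadratic modules are closed under addition\<close>

lemma sum_lessThan_append: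
  "(\<Sum>i<k + l. if i < k then f i else g (i - k)) = (\<Sum>i<k. f i) + (\<Sum>i<l. g (i :: nat) :: 'b::comm_monoid_add)"
  by (induction l) (simp_all add: add.assoc)

lemma sums_of_squaresE:
  assumes "s \<in> sums_of_squares n"
  obtains k q where "s = (\<Sum>i<(k::nat). q i ^ 2)" "\<forall>i<k. q i \<in> polys n"
  using assms unfolding sums_of_squares_def
  by (elim CollectE exE conjE) (rule that, assumption+)

lemma quadratic_moduleE:
  assumes "p \<in> quadratic_module n A"
  obtains s k v where "p = s + (\<Sum>i<(k::nat). v i \<bullet> (A *\<^sub>v v i))" "s \<in> sums_of_squares n"
    "\<forall>i<k. v i \<in> poly_vecs n (dim_row A)"
  using assms unfolding quadratic_module_def
  by (elim CollectE exE conjE) (rule that, assumption+)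

lemma sums_of_squares_add:
  assumes "s \<in> sums_of_squares n" "t \<in> sums_of_squares n"
  shows "s + t \<in> sums_of_squares n"
proof -
  obtain k q where s: "s = (\<Sum>i<(k::nat). q i ^ 2)" "\<forall>i<k. q i \<in> polys n"
    using assms(1) by (rule sums_of_squaresE)
  obtain l r where t: "t = (\<Sum>i<(l::nat). r i ^ 2)" "\<forall>i<l. r i \<in> polys n"
    using assms(2) by (rule sums_of_squaresE)
  let ?w = "\<lambda>i. if i < k then q i else r (i - k)"
  have "s + t = (\<Sum>i<k + l. ?w i ^ 2)"
    unfolding s t sum_lessThan_append[symmetric] by (intro sum.cong) auto
  moreover have "\<forall>i<k + l. ?w i \<in> polys n"
    using s t by auto
  ultimately show ?thesis
    unfolding sums_of_squares_def by (intro CollectI exI[of _ "k + l"] exI[of _ ?w] conjI)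
qed

lemma quadratic_module_add:
  assumes "p \<in> quadratic_module n A" "q \<in> quadratic_module n A"
  shows "p + q \<in> quadratic_module n A"
proof -
  obtain s k v where p: "p = s + (\<Sum>i<(k::nat). v i \<bullet> (A *\<^sub>v v i))" "s \<in> sums_of_squares n"
      "\<forall>i<k. v i \<in> poly_vecs n (dim_row A)"
    using assms(1) by (rule quadratic_moduleE)
  obtain t l w where q: "q = t + (\<Sum>i<(l::nat). w i \<bullet> (A *\<^sub>v w i))" "t \<in> sums_of_squares n"
      "\<forall>i<l. w i \<in> poly_vecs n (dim_row A)"
    using assms(2) by (rule quadratic_moduleE)
  let ?z = "\<lambda>i. if i < k then v i else w (i - k)"
  have "(\<Sum>i<k. v i \<bullet> (A *\<^sub>v v i)) + (\<Sum>i<l. w i \<bullet> (A *\<^sub>v w i)) =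
      (\<Sum>i<k + l. ?z i \<bullet> (A *\<^sub>v ?z i))"
    unfolding sum_lessThan_append[symmetric] by (intro sum.cong) auto
  then have "p + q = (s + t) + (\<Sum>i<k + l. ?z i \<bullet> (A *\<^sub>v ?z i))"
    unfolding p q by (simp add: algebra_simps)
  moreover have "\<forall>i<k + l. ?z i \<in> poly_vecs n (dim_row A)"
    using p q by auto
  ultimately show ?thesis
    using sums_of_squares_add[OF p(2) q(2)] unfolding quadratic_module_def
    by (intro CollectI exI[of _ "s + t"] exI[of _ "k + l"] exI[of _ ?z] conjI)
qed

lemma scalar_prod_mult_mat_vec_eq_form:
  assumes "A \<in> carrier_mat m m" "v \<in> carrier_vec m"
  shows "v \<bullet> (A *\<^sub>v v) = form m (\<lambda>i j. A $$ (i, j)) (\<lambda>i. v $ i) (\<lambda>i. v $ i)"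
  using assms
  by (simp add: form_def scalar_prod_def sum_distrib_left atLeast0LessThan algebra_simps)

text \<open>For polynomials this is the quadratic module in the whole type, with no bound on the
  variables, in an inductive form that suits \<open>quad_mod\<close>.\<close>

inductive_set generated_quad_mod :: "nat \<Rightarrow> (nat \<Rightarrow> nat \<Rightarrow> 'a::comm_ring_1) \<Rightarrow> 'a set" for m a where
  square: "p\<^sup>2 \<in> generated_quad_mod m a"
| form: "form m a v v \<in> generated_quad_mod m a"
| add: "p \<in> generated_quad_mod m a \<Longrightarrow> q \<in> generated_quad_mod m a \<Longrightarrow> p + q \<in> generated_quad_mod m a"

lemma quad_mod_generated: "quad_mod (generated_quad_mod m a)"
proof
  fix p v assume "v \<in> generated_quad_mod m a"
  then show "p\<^sup>2 * v \<in> generated_quad_mod m a"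
    by induction (auto simp: distrib_left simp flip: power_mult_distrib form_mult_both
        intro: generated_quad_mod.intros)
qed (auto intro: generated_quad_mod.intros)

text \<open>Restriction respects sums and products and fixes the entries of the pencil, so squares
  go to squares and values of the form to values of the form.\<close>

lemma restrict_vars_generated:
  assumes A: "A \<in> carrier_mat m m" and a: "\<And>i j. i < m \<Longrightarrow> j < m \<Longrightarrow> A $$ (i, j) = a i j"
    and a_polys: "\<And>i j. i < m \<Longrightarrow> j < m \<Longrightarrow> a i j \<in> polys n"
    and p: "p \<in> generated_quad_mod m a"
  shows "restrict_vars n p \<in> quadratic_module n A"
  using p
proof induction
  case (square p)
  have "(restrict_vars n p)\<^sup>2 = (\<Sum>i<1::nat. (restrict_vars n p)\<^sup>2)" by simp
  then have "(restrict_vars n p)\<^sup>2 \<in> sums_of_squares n"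
    unfolding sums_of_squares_def
    by (intro CollectI exI[of _ 1] exI[of _ "\<lambda>_. restrict_vars n p"]) (simp add: restrict_vars_in_polys)
  then show ?case
    unfolding quadratic_module_def
    by (intro CollectI exI[of _ "(restrict_vars n p)\<^sup>2"] exI[of _ 0])
      (simp add: power2_eq_square restrict_vars_mult)
next
  case (form v)
  define w where "w = vec m (\<lambda>i. restrict_vars n (v i))"
  have w: "w \<in> carrier_vec m" "w \<in> poly_vecs n (dim_row A)"
    using A by (auto simp: w_def poly_vecs_def restrict_vars_in_polys)
  have "restrict_vars n (form m a v v) = w \<bullet> (A *\<^sub>v w)"
    unfolding scalar_prod_mult_mat_vec_eq_form[OF A w(1)]
    by (simp add: form_def restrict_vars_sum restrict_vars_mult w_def a restrict_vars_id a_polys)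
  moreover have "0 \<in> sums_of_squares n"
    unfolding sums_of_squares_def by (intro CollectI exI[of _ 0] exI[of _ "\<lambda>_. 0"]) simp
  ultimately show ?case
    unfolding quadratic_module_def using w(2)
    by (intro CollectI exI[of _ 0] exI[of _ 1] exI[of _ "\<lambda>_. w"]) simp
next
  case (add p q)
  then show ?case by (simp add: restrict_vars_add quadratic_module_add)
qed

section \<open>Coordinates of affine polynomials\<close>

definition affine_monomial :: "nat \<Rightarrow> nat \<Rightarrow>\<^sub>0 nat" where
  "affine_monomial k = (case k of 0 \<Rightarrow> 0 | Suc i \<Rightarrow> Poly_Mapping.single i 1)"

lemma inj_affine_monomial: "inj affine_monomial"
proof (rule injI)
  fix k l assume eq: "affine_monomial k = affine_monomial l"
  have "Poly_Mapping.keys (affine_monomial k) = (case k of 0 \<Rightarrow> {} | Suc i \<Rightarrow> {i})" for k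
    by (simp add: affine_monomial_def split: nat.split)
  then show "k = l" using arg_cong[OF eq, of Poly_Mapping.keys] by (simp split: nat.splits)
qed

lemma monomial_degree_le_1:
  assumes "monomial_degree m \<le> 1" "Poly_Mapping.keys m \<subseteq> {..<n}"
  shows "m \<in> affine_monomial ` {..n}"
proof (cases "m = 0")
  case True
  then show ?thesis by (intro image_eqI[of _ _ 0]) (auto simp: affine_monomial_def)
next
  case False
  then obtain i where i: "i \<in> Poly_Mapping.keys m" by fastforce
  have "(\<Sum>j\<in>Poly_Mapping.keys m. Poly_Mapping.lookup m j) =
      Poly_Mapping.lookup m i + (\<Sum>j\<in>Poly_Mapping.keys m - {i}. Poly_Mapping.lookup m j)"
    using i by (simp add: sum.remove)
  moreover have "0 < Poly_Mapping.lookup m i" using i by (simp add: in_keys_iff)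
  ultimately have i1: "Poly_Mapping.lookup m i = 1"
    and "(\<Sum>j\<in>Poly_Mapping.keys m - {i}. Poly_Mapping.lookup m j) = 0"
    using assms(1) unfolding monomial_degree_def by linarith+
  then have "\<forall>j\<in>Poly_Mapping.keys m - {i}. Poly_Mapping.lookup m j = 0"
    by (subst (asm) sum_eq_0_iff) auto
  then have "Poly_Mapping.lookup m j = 0" if "j \<noteq> i" for j
    using that not_in_keys_iff_lookup_eq_zero[of j m] by blast
  then have "m = Poly_Mapping.single i 1"
    using i1 by (intro poly_mapping_eqI) (auto simp: lookup_single when_def)
  then show ?thesis
    using i assms(2) by (intro image_eqI[of _ _ "Suc i"]) (auto simp: affine_monomial_def)
qed

text \<open>Applied to every entry of a pencil, this produces its real coefficient matrices: index 0
  for the constant term, \<open>Suc i\<close> for the variable with index \<open>i\<close>.\<close>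

lemma affine_poly_expansion:
  assumes "p \<in> polys n" "total_degree p \<le> 1"
  shows "p = (\<Sum>k\<le>n. Poly_Mapping.lookup p (affine_monomial k) *\<^sub>R
    Poly_Mapping.single (affine_monomial k) 1)"
proof -
  have "monomial_degree m \<le> 1" if "m \<in> Poly_Mapping.keys p" for m
    using assms(2) that by (auto simp: total_degree_def)
  then have "Poly_Mapping.keys p \<subseteq> affine_monomial ` {..n}"
    using assms(1) monomial_degree_le_1 by (auto simp: polys_def)
  then have "p = (\<Sum>m\<in>affine_monomial ` {..n}. Poly_Mapping.single m (Poly_Mapping.lookup p m))"
    by (simp add: sum_single_lookup)
  also have "\<dots> = (\<Sum>k\<le>n. Poly_Mapping.single (affine_monomial k) (Poly_Mapping.lookup p (affine_monomial k)))"
    using inj_affine_monomial by (simp add: sum.reindex inj_on_def)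
  also have "\<dots> = (\<Sum>k\<le>n. Poly_Mapping.lookup p (affine_monomial k) *\<^sub>R
      Poly_Mapping.single (affine_monomial k) 1)"
    by (intro sum.cong refl poly_mapping_eqI) (simp add: lookup_scaleR lookup_single when_def)
  finally show ?thesis .
qed

lemma eval_poly_scaleR: "eval_poly x (r *\<^sub>R p) = r * eval_poly x p"
  by (subst eval_poly_superset[of "Poly_Mapping.keys p"])
    (auto simp: lookup_scaleR in_keys_iff eval_poly_superset[of "Poly_Mapping.keys p" p]
      sum_distrib_left mult.assoc)

section \<open>The two implications\<close>

lemma spectrahedron_empty_if_minus_one:
  assumes "A \<in> carrier_mat m m" "- 1 \<in> quadratic_module n A"
  shows "spectrahedron n A = {}"
proof (rule ccontr)
  assume "spectrahedron n A \<noteq> {}"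
  then obtain x where x: "pos_semidef (map_mat (eval_poly x) A)"
    by (auto simp: spectrahedron_def)
  obtain s k v where e: "- 1 = s + (\<Sum>i<(k::nat). v i \<bullet> (A *\<^sub>v v i))" and s: "s \<in> sums_of_squares n"
    and v: "\<forall>i<k. v i \<in> poly_vecs n (dim_row A)"
    using assms(2) by (rule quadratic_moduleE)
  obtain l q where s': "s = (\<Sum>i<(l::nat). q i ^ 2)"
    using s by (rule sums_of_squaresE)
  \<comment> \<open>Evaluation at \<open>x\<close> turns both kinds of summand into nonnegative
    reals, whereas \<open>- 1\<close> evaluates to a negative one.\<close>
  have "0 \<le> eval_poly x s"
    by (auto simp: s' eval_poly_sum power2_eq_square eval_poly_mult intro: sum_nonneg)
  moreover have "0 \<le> eval_poly x (v i \<bullet> (A *\<^sub>v v i))" if "i < k" for i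
  proof -
    have vi: "v i \<in> carrier_vec m" using v that assms(1) by (auto simp: poly_vecs_def)
    let ?w = "map_vec (eval_poly x) (v i)" and ?B = "map_mat (eval_poly x) A"
    have w: "?w \<in> carrier_vec m" and B: "?B \<in> carrier_mat m m" using vi assms(1) by auto
    have "eval_poly x (v i \<bullet> (A *\<^sub>v v i)) = ?w \<bullet> (?B *\<^sub>v ?w)"
      unfolding scalar_prod_mult_mat_vec_eq_form[OF assms(1) vi] scalar_prod_mult_mat_vec_eq_form[OF B w]
        eval_poly_form
      using vi assms(1) by (simp add: form_def)
    also have "0 \<le> \<dots>" using x w assms(1) by (auto simp: pos_semidef_def)
    finally show ?thesis .
  qed
  then have "0 \<le> eval_poly x (\<Sum>i<k. v i \<bullet> (A *\<^sub>v v i))"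
    by (auto simp: eval_poly_sum intro: sum_nonneg)
  moreover have "eval_poly x (- 1) = -1"
    by (simp add: eval_poly_uminus eval_poly_one)
  ultimately show False by (simp add: e eval_poly_add)
qed

lemma spectrahedron_nonempty_if_proper:
  assumes A: "linear_pencil n m A" and proper: "- 1 \<notin> quadratic_module n A"
  shows "spectrahedron n A \<noteq> {}"
proof -
  have carrier: "A \<in> carrier_mat m m" and sym: "transpose_mat A = A"
    and entry: "\<And>i j. i < m \<Longrightarrow> j < m \<Longrightarrow> A $$ (i, j) \<in> polys n \<and> total_degree (A $$ (i, j)) \<le> 1"
    using A by (auto simp: linear_pencil_def)
  have A_sym: "A $$ (i, j) = A $$ (j, i)" if "i < m" "j < m" for i j
    using that carrier arg_cong[OF sym, of "\<lambda>B. B $$ (i, j)"] by simp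
  define coef where "coef k i j = Poly_Mapping.lookup (A $$ (i, j)) (affine_monomial k)" for k i j
  define b :: "nat \<Rightarrow> real_poly" where "b k = Poly_Mapping.single (affine_monomial k) 1" for k
  define a where "a i j = (\<Sum>k\<le>n. coef k i j *\<^sub>R b k)" for i j
  have a: "A $$ (i, j) = a i j" if "i < m" "j < m" for i j
    unfolding a_def coef_def b_def using entry[OF that] by (intro affine_poly_expansion) auto
  \<comment> \<open>The maximal module is taken in the ring of all polynomials; restriction of
    variables fixes \<open>- 1\<close> and so carries properness over from
    \<open>quadratic_module n A\<close>.\<close>
  have "- 1 \<notin> generated_quad_mod m a"
  proof
    assume "- 1 \<in> generated_quad_mod m a"
    from restrict_vars_generated[OF carrier a _ this, of n]
    have "restrict_vars n (- 1) \<in> quadratic_module n A"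
      using entry a by metis
    moreover have "- 1 \<in> polys n" by (simp add: polys_def)
    ultimately show False using proper by (simp add: restrict_vars_id)
  qed
  then obtain M where M: "maximal_quad_mod M" "generated_quad_mod m a \<subseteq> M"
    using maximal_quad_mod_exists[OF quad_mod_generated] by blast
  interpret maximal_quad_mod M by (rule M(1))
  have "b 0 = 1" by (simp add: b_def affine_monomial_def)
  moreover have "form m a v v \<in> M" for v
    using M(2) generated_quad_mod.form by blast
  ultimately obtain f where f: "f 0 = 1" "\<And>u. 0 \<le> (\<Sum>k\<le>n. f k * form m (coef k) u u)"
    using real_point_exists[of "{..n}" 0 b a coef m] a_def A_sym by (auto simp: coef_def)
  \<comment> \<open>The coordinates are the values of the functional at the variables. As
    \<open>f 0 = 1\<close>, evaluation at \<open>x\<close> agrees with the functional on affine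
    polynomials, hence on the entries of the pencil.\<close>
  define x where "x = vec n (\<lambda>i. f (Suc i))"
  have eval_b: "eval_poly x (b k) = f k" if "k \<le> n" for k
    using that f(1)
    by (auto simp: b_def eval_poly_single affine_monomial_def monomial_value_def x_def split: nat.split)
  have eval_A: "eval_poly x (A $$ (i, j)) = (\<Sum>k\<le>n. coef k i j * f k)" if "i < m" "j < m" for i j
    by (simp add: a[OF that] a_def eval_poly_sum eval_poly_scaleR eval_b)
  let ?B = "map_mat (eval_poly x) A"
  have B: "?B \<in> carrier_mat m m" using carrier by simp
  have "0 \<le> u \<bullet> (?B *\<^sub>v u)" if u: "u \<in> carrier_vec m" for u
  proof -
    have "u \<bullet> (?B *\<^sub>v u) = (\<Sum>i<m. \<Sum>j<m. \<Sum>k\<le>n. f k * (u $ i * u $ j * coef k i j))"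
      unfolding scalar_prod_mult_mat_vec_eq_form[OF B u] form_def
      using carrier by (intro sum.cong) (auto simp: eval_A sum_distrib_left algebra_simps)
    also have "\<dots> = (\<Sum>i<m. \<Sum>k\<le>n. \<Sum>j<m. f k * (u $ i * u $ j * coef k i j))"
      by (intro sum.cong refl sum.swap)
    also have "\<dots> = (\<Sum>k\<le>n. \<Sum>i<m. \<Sum>j<m. f k * (u $ i * u $ j * coef k i j))"
      by (rule sum.swap)
    also have "\<dots> = (\<Sum>k\<le>n. f k * form m (coef k) (\<lambda>i. u $ i) (\<lambda>i. u $ i))"
      by (simp add: form_def sum_distrib_left)
    also have "0 \<le> \<dots>" by (rule f(2))
    finally show ?thesis .
  qed
  moreover have "transpose_mat ?B = ?B"
    using carrier A_sym by (intro eq_matI) auto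
  ultimately have "pos_semidef ?B"
    using carrier by (auto simp: pos_semidef_def)
  then have "x \<in> spectrahedron n A"
    by (simp add: spectrahedron_def x_def)
  then show ?thesis by blast
qed

theorem corollary4p3p1:
  fixes n \<alpha> :: nat and A :: "real_poly mat"
  assumes "linear_pencil n \<alpha> A"
  shows "spectrahedron n A = {} \<longleftrightarrow> - 1 \<in> quadratic_module n A"
  using assms spectrahedron_nonempty_if_proper spectrahedron_empty_if_minus_one[of A \<alpha> n]
  by (auto simp: linear_pencil_def)

end
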